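(* Let $q\ge 1$, let $A_\ell(z)=\sum_{i=0}^\infty A_{\ell,i}z^i$, $\ell=-1,0,\ldots,q$, be matrix power series with $A_{\ell,i}\ge0$ for all $\ell,i$ and $\sum_{\ell=-1}^q A_\ell(z)z^{\ell+1}=\sum_{i=-1}^\infty A_iz^{i+1}$, and assume that $A_{-1}(z)=A_{-1}$ (constant). Let $\{X_k^{(1)}\}_k$ be the sequence with $X_0^{(1)}=0$ in which $X_{k+1}^{(1)}$ is the minimal nonnegative solution $X$ of $X=\sum_{\ell=-1}^q A_\ell(X_k^{(1)})X^{\ell+1}$, and let $\{X_k^{(2)}\}_k$ be the sequence generated by the $U$-based iteration $$\Big(I-\sum_{i=0}^\infty A_i (X_k^{(2)})^i\Big)X_{k+1}^{(2)}=A_{-1},\qquad k\ge 0,\quad X_0^{(2)}=0.$$ Then $\{X_k^{(1)}\}_k$ converges faster than $\{X_k^{(2)}\}_k$, in the sense that their asymptotic rates of convergence satisfy $r^{(1)}\le r^{(2)}$.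
   Context: Standing assumptions: $A_i$, $i\ge-1$, and $B_i$, $i\ge 0$, are nonnegative $m\times m$ matrices with $\sum_{i\ge0}B_i$ stochastic and $A=\sum_{i\ge -1}A_i$ stochastic and irreducible; the Markov chain with transition matrix $$P=\begin{bmatrix}B_0&B_1&B_2&\cdots\\ A_{-1}&A_0&A_1&\cdots\\ &A_{-1}&A_0&\ddots\\ &&\ddots&\ddots\end{bmatrix}$$ is irreducible and aperiodic; the series $\sum_{i\ge-1}iA_i$ converges. Inequalities are entrywise; $\mathbf 1$ is the all-ones vector. $G$ denotes the minimal nonnegative solution of $X=\sum_{i=-1}^\infty A_iX^{i+1}$ (it exists and $G\mathbf 1\le\mathbf 1$); "minimal" means entrywise less than or equal to every other nonnegative solution. For a matrix $X$, $A_\ell(X)=\sum_{i\ge0}A_{\ell,i}X^i$ with $X^0=I$. Both sequences are well defined and converge monotonically to $G$ from below. For a sequence $\{X_k\}_k$ with limit $G$ and $X_0=0$, set $\boldsymbol\epsilon_k=(G-X_k)\mathbf 1\ge 0$; its asymptotic rate of convergence is $r=\limsup_{k\to\infty}\left(\|\boldsymbol\epsilon_k\|_\infty/\|\boldsymbol\epsilon_0\|_\infty\right)^{1/k}$. A sequence with rate $r^{(1)}$ is said to converge faster than one with rate $r^{(2)}$ if $r^{(1)}\le r^{(2)}$. *)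

theory Defs
  imports "HOL-Analysis.Analysis" "HOL-Computational_Algebra.Formal_Power_Series"
begin

type_synonym 'm sqmat = "real ^ 'm ^ 'm"

text \<open>The operators \<open>*\<close> and \<open>^\<close> on \<^typ>\<open>real ^ 'm ^ 'm\<close> act entrywise, so powers with
  respect to the matrix product \<open>**\<close> are defined here. The relation \<open>\<le>\<close> on
  \<^typ>\<open>real ^ 'm ^ 'm\<close> is the entrywise order.\<close>

primrec matpow :: "('m::finite) sqmat \<Rightarrow> nat \<Rightarrow> 'm sqmat" where
  "matpow X 0 = mat 1"
| "matpow X (Suc n) = X ** matpow X n"

definition ones :: "real ^ 'm" where
  "ones = (\<chi> i. 1)"

definition stochastic :: "('m::finite) sqmat \<Rightarrow> bool" where
  "stochastic M \<longleftrightarrow> 0 \<le> M \<and> M *v ones = ones"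


text \<open>Nonnegative, possibly infinite matrices are functions of two indices;
  \<open>nstep P n s t\<close> is the \<open>(s, t)\<close> entry of the \<open>n\<close>-th power of \<open>P\<close>.\<close>

primrec nstep :: "('s \<Rightarrow> 's \<Rightarrow> real) \<Rightarrow> nat \<Rightarrow> 's \<Rightarrow> 's \<Rightarrow> real" where
  "nstep P 0 s t = (if s = t then 1 else 0)"
| "nstep P (Suc n) s t = (\<Sum>\<^sub>\<infinity>u. P s u * nstep P n u t)"

definition irreducible_chain :: "('s \<Rightarrow> 's \<Rightarrow> real) \<Rightarrow> bool" where
  "irreducible_chain P \<longleftrightarrow> (\<forall>s t. \<exists>n. nstep P n s t > 0)"

definition aperiodic_chain :: "('s \<Rightarrow> 's \<Rightarrow> real) \<Rightarrow> bool" where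
  "aperiodic_chain P \<longleftrightarrow> (\<forall>s. Gcd {n. 0 < n \<and> nstep P n s s > 0} = 1)"

definition irreducible_mat :: "('m::finite) sqmat \<Rightarrow> bool" where
  "irreducible_mat M \<longleftrightarrow> irreducible_chain (\<lambda>a b. M $ a $ b)"

text \<open>The state \<open>(i, a)\<close> is phase \<open>a\<close> of level \<open>i\<close>: block row \<open>0\<close> is
  \<open>B 0, B 1, B 2, \<dots>\<close>, and block \<open>(i, j)\<close> with \<open>i \<ge> 1\<close> is \<open>A (j - i)\<close>, or zero
  if \<open>j < i - 1\<close>. Only the values of \<open>A\<close> at indices \<open>\<ge> -1\<close> matter, here and below.\<close>

fun mg1_matrix :: "(int \<Rightarrow> ('m::finite) sqmat) \<Rightarrow> (nat \<Rightarrow> 'm sqmat)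
    \<Rightarrow> nat \<times> 'm \<Rightarrow> nat \<times> 'm \<Rightarrow> real" where
  "mg1_matrix A B (i, a) (j, b) =
     (if i = 0 then B j $ a $ b
      else if int j - int i \<ge> -1 then A (int j - int i) $ a $ b
      else 0)"


definition min_nonneg :: "(('m::finite) sqmat \<Rightarrow> bool) \<Rightarrow> 'm sqmat \<Rightarrow> bool" where
  "min_nonneg S X \<longleftrightarrow> 0 \<le> X \<and> S X \<and> (\<forall>Y. 0 \<le> Y \<and> S Y \<longrightarrow> X \<le> Y)"

text \<open>Summation over \<open>i \<ge> -1\<close> is written as summation over \<open>n = i + 1\<close>. Being a solution
  includes convergence of the series.\<close>

definition solves_mg1 :: "(int \<Rightarrow> ('m::finite) sqmat) \<Rightarrow> 'm sqmat \<Rightarrow> bool" where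
  "solves_mg1 A X \<longleftrightarrow> (\<lambda>n. A (int n - 1) ** matpow X n) sums X"

definition mat_series :: "(nat \<Rightarrow> ('m::finite) sqmat) \<Rightarrow> 'm sqmat \<Rightarrow> 'm sqmat" where
  "mat_series C X = (\<Sum>i. C i ** matpow X i)"

text \<open>\<open>AL l i\<close> is the coefficient of \<open>z ^ i\<close> in the matrix power series \<open>A\<^sub>l(z)\<close>.
  The equation between matrix power series in the scalar indeterminate \<open>z\<close> is stated
  entry by entry.\<close>

definition series_splitting ::
    "(int \<Rightarrow> ('m::finite) sqmat) \<Rightarrow> nat \<Rightarrow> (int \<Rightarrow> nat \<Rightarrow> 'm sqmat) \<Rightarrow> bool" where
  "series_splitting A q AL \<longleftrightarrow>
     (\<forall>a b. (\<Sum>l = -1..int q. Abs_fps (\<lambda>i. AL l i $ a $ b) * fps_X ^ nat (l + 1))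
            = Abs_fps (\<lambda>n. A (int n - 1) $ a $ b))"

definition error_vec :: "('m::finite) sqmat \<Rightarrow> (nat \<Rightarrow> 'm sqmat) \<Rightarrow> nat \<Rightarrow> real ^ 'm" where
  "error_vec G X k = (G - X k) *v ones"

text \<open>On \<^typ>\<open>real ^ 'm\<close>, \<^const>\<open>infnorm\<close> is the maximum norm. The value at \<open>k = 0\<close>
  does not affect the limit superior.\<close>

definition conv_rate :: "('m::finite) sqmat \<Rightarrow> (nat \<Rightarrow> 'm sqmat) \<Rightarrow> ereal" where
  "conv_rate G X = limsup (\<lambda>k.
     ereal (root k (infnorm (error_vec G X k) / infnorm (error_vec G X 0))))"

end

theory Submission
  imports Defs
begin

text \<open>
  The entrywise inequalities \<open>X2 k \<le> X1 k \<le> G\<close> hold for all \<open>k\<close>, so the errors, and with them the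
  rates, are ordered. A minimal nonnegative solution lies below every supersolution, by the
  Knaster--Tarski argument on an order interval; this makes \<open>X1\<close> increasing and bounded by \<open>G\<close>.
  The new iterate \<open>Y = X1 (k + 1)\<close> satisfies \<open>Y = A\<^bsub>-1\<^esub> + V Y\<close> where, since \<open>X1 k \<le> Y\<close> and
  \<open>A\<^bsub>-1\<^esub>(z)\<close> is constant, \<open>V\<close> dominates \<open>\<Sum>i\<ge>0. A\<^sub>i (X1 k)\<^sup>i\<close> and hence
  \<open>W = \<Sum>i\<ge>0. A\<^sub>i (X2 k)\<^sup>i\<close>. As \<open>X = X2 (k + 1)\<close> satisfies \<open>X = A\<^bsub>-1\<^esub> + W X\<close>, the difference
  \<open>X - Y\<close> is at most \<open>W (X - Y)\<close>. Finally, \<open>D \<le> W D\<close> forces \<open>D \<le> 0\<close>: otherwise \<open>W\<close>, which is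
  dominated by \<open>\<Sum>i\<ge>0. A\<^sub>i G\<^sup>i\<close>, would have a stochastic closed class, the rows of \<open>G\<close> in that class would be
  zero by minimality, and the chain could not reach level \<open>0\<close> from there.
\<close>


section \<open>Comparison of series and fixed points in order intervals\<close>

lemma sums_le_eucl:
  fixes f g :: "nat \<Rightarrow> 'a::ordered_euclidean_space"
  assumes "\<And>n. f n \<le> g n" "f sums a" "g sums b"
  shows "a \<le> b"
proof -
  have "(\<lambda>n. \<Sum>i<n. g i - f i) \<longlonglongrightarrow> b - a"
    using sums_diff[OF assms(3,2)] by (simp add: sums_def)
  moreover have "(\<Sum>i<n. g i - f i) \<in> {0..}" for n
    using assms(1) by (simp add: sum_nonneg)
  ultimately have "b - a \<in> {0..}"
    using closed_sequentially[OF closed_eucl_atLeast, of "\<lambda>n. \<Sum>i<n. g i - f i" 0 "b - a"]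
    by simp
  then show ?thesis by simp
qed

lemma member_le_sums_eucl:
  fixes f :: "nat \<Rightarrow> 'a::ordered_euclidean_space"
  assumes "\<And>n. 0 \<le> f n" "f sums a"
  shows "f n \<le> a"
  using sums_le_eucl[of "\<lambda>k. if k = n then f k else 0" f, OF _ sums_single assms(2)] assms(1)
  by simp

text \<open>Knaster--Tarski: the infimum of the prefixpoints between \<open>l\<close> and
  \<open>s\<close> is fixed. The interval supplies the bounds that a merely conditionally complete
  lattice requires. Monotonicity is asked for only there, because matrix series are controlled only
  below a substochastic matrix.\<close>

lemma fixpoint_below_prefixpoint:
  fixes f :: "'a::conditionally_complete_lattice \<Rightarrow> 'a"
  assumes "l \<le> s" "f s \<le> s"
    and lower: "\<And>x. l \<le> x \<Longrightarrow> x \<le> s \<Longrightarrow> l \<le> f x"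
    and mono: "\<And>x y. l \<le> x \<Longrightarrow> x \<le> y \<Longrightarrow> y \<le> s \<Longrightarrow> f x \<le> f y"
  obtains x where "l \<le> x" "x \<le> s" "f x = x"
proof -
  define K where "K = {x. l \<le> x \<and> x \<le> s \<and> f x \<le> x}"
  define t where "t = Inf K"
  have sK: "s \<in> K" and bdd: "bdd_below K"
    using assms(1,2) by (auto simp: K_def bdd_below_def)
  have t_le: "t \<le> x" if "x \<in> K" for x
    using that bdd by (simp add: t_def cInf_lower)
  have l_le: "l \<le> t"
    unfolding t_def using sK by (intro cInf_greatest) (auto simp: K_def)
  have "f t \<le> x" if "x \<in> K" for x
    using mono[OF l_le t_le[OF that]] that by (auto simp: K_def)
  then have ft: "f t \<le> t"
    unfolding t_def using sK by (intro cInf_greatest) auto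
  have ts: "t \<le> s" using t_le[OF sK] .
  have "f t \<in> K"
    unfolding K_def using lower[OF l_le ts] ft ts mono[of "f t" t] by auto
  from t_le[OF this] ft have "f t = t" by simp
  with l_le ts that show ?thesis by blast
qed

section \<open>Matrix algebra in the entrywise order\<close>

lemma matrix_mult_mono:
  fixes A A' :: "real ^ 'n ^ 'm" and B B' :: "real ^ 'p ^ 'n"
  assumes "A \<le> A'" "B \<le> B'" "0 \<le> A'" "0 \<le> B"
  shows "A ** B \<le> A' ** B'"
  using assms by (auto simp: less_eq_vec_def matrix_matrix_mult_def intro!: sum_mono mult_mono)

lemma matrix_mult_nonneg:
  fixes A :: "real ^ 'n ^ 'm" and B :: "real ^ 'p ^ 'n"
  assumes "0 \<le> A" "0 \<le> B"
  shows "0 \<le> A ** B"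
  using assms by (auto simp: less_eq_vec_def matrix_matrix_mult_def intro!: sum_nonneg)

lemma matrix_vector_mult_nonneg:
  fixes A :: "real ^ 'n ^ 'm"
  assumes "0 \<le> A" "0 \<le> x"
  shows "0 \<le> A *v x"
  using assms by (auto simp: less_eq_vec_def matrix_vector_mult_def intro!: sum_nonneg)

lemma matrix_vector_mult_mono:
  fixes A A' :: "real ^ 'n ^ 'm"
  assumes "A \<le> A'" "x \<le> x'" "0 \<le> A'" "0 \<le> x"
  shows "A *v x \<le> A' *v x'"
  using assms by (auto simp: less_eq_vec_def matrix_vector_mult_def intro!: sum_mono mult_mono)

lemma matrix_add_rdistrib:
  fixes A B :: "real ^ 'n ^ 'm" and C :: "real ^ 'p ^ 'n"
  shows "(A + B) ** C = A ** C + B ** C"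
  by (simp add: matrix_matrix_mult_def vec_eq_iff sum.distrib algebra_simps)

lemma bounded_linear_matrix_mult_left:
  fixes X :: "real ^ 'p ^ 'n"
  shows "bounded_linear (\<lambda>M :: real ^ 'n ^ 'm. M ** X)"
  unfolding linear_conv_bounded_linear[symmetric]
  by (rule linearI) (simp_all add: matrix_add_rdistrib scalar_matrix_assoc)

lemma bounded_linear_matrix_vector_left:
  fixes x :: "real ^ 'n"
  shows "bounded_linear (\<lambda>M :: real ^ 'n ^ 'm. M *v x)"
  unfolding linear_conv_bounded_linear[symmetric]
  by (rule linearI) (simp_all add: matrix_vector_mult_add_rdistrib scaleR_matrix_vector_assoc)

lemma ones_nonneg: "0 \<le> ones"
  by (simp add: ones_def less_eq_vec_def)

lemma matpow_Suc_right: "matpow X (Suc n) = matpow X n ** X"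
proof (induction n)
  case (Suc n)
  then show ?case by (metis matpow.simps(2) matrix_mul_assoc)
qed simp

lemma matpow_add: "matpow X (m + n) = matpow X m ** matpow X n"
  by (induction m) (simp_all add: matrix_mul_assoc)

lemma mat_1_nonneg: "0 \<le> (mat 1 :: real ^ 'm ^ 'm)"
  by (simp add: mat_def less_eq_vec_def)

lemma matpow_nonneg: "0 \<le> X \<Longrightarrow> 0 \<le> matpow X n"
  by (induction n) (simp_all add: mat_1_nonneg matrix_mult_nonneg)

lemma matpow_mono: "0 \<le> X \<Longrightarrow> X \<le> Y \<Longrightarrow> matpow X n \<le> matpow Y n"
proof (induction n)
  case (Suc n)
  then show ?case
    using order_trans[OF Suc.prems] by (simp add: matrix_mult_mono matpow_nonneg)
qed simp

section \<open>Substochastic matrices and convergence of matrix power series\<close>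

text \<open>The domain on which \<open>mat_series\<close> is controlled: powers of such a matrix
  keep row sums at most one, so summable nonnegative coefficients give a convergent series.\<close>

definition substochastic :: "('m::finite) sqmat \<Rightarrow> bool" where
  "substochastic M \<longleftrightarrow> 0 \<le> M \<and> M *v ones \<le> ones"

lemma substochastic_mono: "0 \<le> X \<Longrightarrow> X \<le> Y \<Longrightarrow> substochastic Y \<Longrightarrow> substochastic X"
  unfolding substochastic_def
  using matrix_vector_mult_mono[of X Y ones ones] ones_nonneg order_trans by auto

lemma matpow_ones_nonneg: "0 \<le> X \<Longrightarrow> 0 \<le> matpow X n *v ones"
  by (simp add: matrix_vector_mult_nonneg matpow_nonneg ones_nonneg)

lemma matpow_ones_le: "substochastic X \<Longrightarrow> matpow X n *v ones \<le> ones"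
proof (induction n)
  case (Suc n)
  have X: "0 \<le> X" "X *v ones \<le> ones" using Suc.prems by (auto simp: substochastic_def)
  have "X *v (matpow X n *v ones) \<le> X *v ones"
    using matrix_vector_mult_mono[OF order_refl Suc.IH[OF Suc.prems] X(1)]
      matpow_ones_nonneg[OF X(1)] by blast
  from order_trans[OF this X(2)] show ?case
    by (simp add: matrix_vector_mul_assoc[symmetric])
qed simp

lemma mult_matpow_ones_le:
  assumes "substochastic X" "0 \<le> C"
  shows "(C ** matpow X n) *v ones \<le> C *v ones"
  unfolding matrix_vector_mul_assoc[symmetric]
  using assms by (intro matrix_vector_mult_mono order_refl matpow_ones_le matpow_ones_nonneg)
    (auto simp: substochastic_def)

text \<open>Linear in \<open>M\<close>, and above the norm for nonnegative \<open>M\<close>: it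
  turns summability of matrices into real majorants for the comparison test and the M-test.\<close>

definition entry_sum :: "('m::finite) sqmat \<Rightarrow> real" where
  "entry_sum M = (\<Sum>a\<in>UNIV. (M *v ones) $ a)"

lemma norm_le_entry_sum:
  assumes "0 \<le> M"
  shows "norm M \<le> entry_sum M"
proof -
  have "norm M \<le> (\<Sum>a\<in>UNIV. norm (M $ a))"
    by (simp add: norm_vec_def L2_set_le_sum)
  also have "\<dots> \<le> (\<Sum>a\<in>UNIV. \<Sum>b\<in>UNIV. \<bar>M $ a $ b\<bar>)"
    by (intro sum_mono norm_le_l1_cart)
  also have "\<dots> = entry_sum M"
    using assms by (simp add: entry_sum_def ones_def matrix_vector_mult_def less_eq_vec_def)
  finally show ?thesis .
qed

lemma summable_entry_sum: "summable C \<Longrightarrow> summable (\<lambda>n. entry_sum (C n))"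
  unfolding entry_sum_def
  by (intro summable_sum summable_vec_nth bounded_linear.summable[OF bounded_linear_matrix_vector_left])

lemma norm_mult_matpow_le:
  assumes "substochastic X" "0 \<le> C"
  shows "norm (C ** matpow X n) \<le> entry_sum C"
proof -
  have "norm (C ** matpow X n) \<le> entry_sum (C ** matpow X n)"
    using assms by (simp add: norm_le_entry_sum matrix_mult_nonneg matpow_nonneg substochastic_def)
  also have "\<dots> \<le> entry_sum C"
    using mult_matpow_ones_le[OF assms] unfolding entry_sum_def
    by (intro sum_mono) (simp add: less_eq_vec_def)
  finally show ?thesis .
qed

lemma summable_nonneg_comparison:
  fixes C D :: "nat \<Rightarrow> ('m::finite) sqmat"
  assumes "summable D" "\<And>n. 0 \<le> C n" "\<And>n. C n \<le> D n"
  shows "summable C"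
proof (rule summable_comparison_test'[OF summable_entry_sum[OF assms(1)]])
  fix n :: nat
  have "entry_sum (C n) \<le> entry_sum (D n)"
    using matrix_vector_mult_mono[OF assms(3)[of n] order_refl _ ones_nonneg]
      order_trans[OF assms(2,3)]
    unfolding entry_sum_def by (intro sum_mono) (simp add: less_eq_vec_def)
  with norm_le_entry_sum[OF assms(2)[of n]] show "norm (C n) \<le> entry_sum (D n)" by simp
qed

context
  fixes C :: "nat \<Rightarrow> ('m::finite) sqmat"
  assumes C_nonneg: "\<And>n. 0 \<le> C n" and C_summable: "summable C"
begin

lemma mat_series_sums:
  assumes "substochastic X"
  shows "(\<lambda>i. C i ** matpow X i) sums mat_series C X"
  unfolding mat_series_def
  by (intro summable_sums summable_comparison_test'[OF summable_entry_sum[OF C_summable]]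
      norm_mult_matpow_le assms C_nonneg)

lemma mat_series_nonneg: "substochastic X \<Longrightarrow> 0 \<le> mat_series C X"
  by (rule sums_le_eucl[OF _ sums_zero mat_series_sums])
    (simp_all add: C_nonneg matpow_nonneg matrix_mult_nonneg substochastic_def)

lemma mat_series_mono:
  assumes "0 \<le> X" "X \<le> Y" "substochastic Y"
  shows "mat_series C X \<le> mat_series C Y"
  using substochastic_mono[OF assms] assms
  by (intro sums_le_eucl[OF _ mat_series_sums mat_series_sums])
    (simp_all add: C_nonneg matrix_mult_mono matpow_mono matpow_nonneg)

lemma mat_series_ones_le:
  assumes "substochastic X"
  shows "mat_series C X *v ones \<le> suminf C *v ones"
  by (rule sums_le_eucl[OF mult_matpow_ones_le[OF assms C_nonneg]
        bounded_linear.sums[OF bounded_linear_matrix_vector_left mat_series_sums[OF assms]]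
        bounded_linear.sums[OF bounded_linear_matrix_vector_left summable_sums[OF C_summable]]])

text \<open>One factor \<open>X\<close> of each higher power is split off on the right. A nonlinear
  equation \<open>X = mat_series C X\<close> thereby takes the form \<open>X = C 0 + U ** X\<close>,
  with \<open>U\<close> a series in \<open>X\<close>.\<close>

lemma mat_series_Suc:
  assumes "substochastic X"
  shows "mat_series C X = C 0 + mat_series (\<lambda>i. C (Suc i)) X ** X"
proof -
  have "(\<lambda>i. C (Suc i) ** matpow X i) sums mat_series (\<lambda>i. C (Suc i)) X"
    unfolding mat_series_def
    by (intro summable_sums norm_mult_matpow_le assms C_nonneg summable_comparison_test'
        [OF summable_entry_sum[OF C_summable[THEN summable_Suc_iff[THEN iffD2]]]])
  from bounded_linear.sums[OF bounded_linear_matrix_mult_left[of X] this]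
  have "(\<lambda>i. C (Suc i) ** matpow X (Suc i)) sums (mat_series (\<lambda>i. C (Suc i)) X ** X)"
    by (simp add: matpow_Suc_right matrix_mul_assoc[symmetric] del: matpow.simps)
  then have "(\<lambda>i. C i ** matpow X i) sums (mat_series (\<lambda>i. C (Suc i)) X ** X + C 0)"
    by (subst (asm) sums_Suc_iff) simp
  from sums_unique2[OF mat_series_sums[OF assms] this] show ?thesis by (simp add: add.commute)
qed

end

section \<open>Minimal nonnegative solutions\<close>

text \<open>Some fixed point of \<open>f\<close> lies below the supersolution \<open>Y\<close>, and
  \<open>X\<close> lies below every solution. Keeping \<open>S\<close> apart from \<open>f\<close>
  covers predicates that include convergence of a series as well as plain equations.\<close>

lemma min_nonneg_le_prefixpoint:
  assumes "min_nonneg S X" "0 \<le> Y" "f Y \<le> Y"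
    and "\<And>Z. 0 \<le> Z \<Longrightarrow> Z \<le> Y \<Longrightarrow> 0 \<le> f Z"
    and "\<And>Z Z'. 0 \<le> Z \<Longrightarrow> Z \<le> Z' \<Longrightarrow> Z' \<le> Y \<Longrightarrow> f Z \<le> f Z'"
    and S: "\<And>Z. 0 \<le> Z \<Longrightarrow> Z \<le> Y \<Longrightarrow> f Z = Z \<Longrightarrow> S Z"
  shows "X \<le> Y"
proof -
  obtain Z where "0 \<le> Z" "Z \<le> Y" "f Z = Z"
    using fixpoint_below_prefixpoint[of 0 Y f, OF assms(2-5)] by blast
  with S assms(1) have "X \<le> Z" by (simp add: min_nonneg_def)
  with \<open>Z \<le> Y\<close> show ?thesis by simp
qed

text \<open>Row sums at most one bound each entry by one, so the set is a closed part of a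
  box.\<close>

lemma compact_substochastic: "compact {M :: ('m::finite) sqmat. substochastic M}"
proof -
  have "{M. substochastic M} = {0..(\<chi> a b. 1)} \<inter> (\<lambda>M :: 'm sqmat. M *v ones) -` {..ones}"
  proof safe
    fix M :: "'m sqmat" assume M: "substochastic M"
    have "M $ a $ b \<le> 1" for a b
    proof -
      have "M $ a $ b \<le> (\<Sum>b\<in>UNIV. M $ a $ b)"
        using M by (intro member_le_sum) (auto simp: substochastic_def less_eq_vec_def)
      also have "\<dots> \<le> 1"
        using M by (simp add: substochastic_def less_eq_vec_def matrix_vector_mult_def ones_def)
      finally show ?thesis .
    qed
    with M show "M \<in> {0..(\<chi> a b. 1)}" by (simp add: substochastic_def less_eq_vec_def)
  qed (auto simp: substochastic_def)
  moreover have "closed ((\<lambda>M :: 'm sqmat. M *v ones) -` {..ones})"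
    by (intro continuous_closed_vimage closed_eucl_atMost
        linear_continuous_at bounded_linear_matrix_vector_left)
  ultimately show ?thesis by (simp add: compact_Int_closed)
qed

lemma convex_substochastic: "convex {M :: ('m::finite) sqmat. substochastic M}"
proof (rule convexI)
  fix M N :: "'m sqmat" and u v :: real
  assume M: "M \<in> {M. substochastic M}" and N: "N \<in> {M. substochastic M}"
    and uv: "0 \<le> u" "0 \<le> v" "u + v = 1"
  have "u *\<^sub>R (M *v ones) + v *\<^sub>R (N *v ones) \<le> u *\<^sub>R ones + v *\<^sub>R ones"
    using M N uv by (intro add_mono scaleR_left_mono) (auto simp: substochastic_def)
  also have "\<dots> = ones" using uv(3) by (simp add: scaleR_left_distrib[symmetric])
  finally have "(u *\<^sub>R M + v *\<^sub>R N) *v ones \<le> ones"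
    by (simp add: matrix_vector_mult_add_rdistrib scaleR_matrix_vector_assoc)
  moreover have "0 \<le> u *\<^sub>R M + v *\<^sub>R N"
    using M N uv by (intro add_nonneg_nonneg scaleR_nonneg_nonneg) (auto simp: substochastic_def)
  ultimately show "u *\<^sub>R M + v *\<^sub>R N \<in> {M. substochastic M}"
    by (simp add: substochastic_def)
qed


text \<open>Brouwer's theorem produces a substochastic solution, which dominates the minimal one.\<close>

lemma min_solution_substochastic:
  fixes C :: "nat \<Rightarrow> ('m::finite) sqmat"
  assumes C_nonneg: "\<And>n. 0 \<le> C n" and C_summable: "summable C"
    and C_ones: "suminf C *v ones \<le> ones"
    and G: "min_nonneg (\<lambda>X. (\<lambda>n. C n ** matpow X n) sums X) G"
  shows "substochastic G"
proof -
  let ?S = "{M :: 'm sqmat. substochastic M}"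
  have cont_pow: "continuous_on ?S (\<lambda>X. matpow X n)" for n
  proof (induction n)
    case (Suc n)
    then show ?case
      by (auto simp: matrix_matrix_mult_def intro!: continuous_intros)
  qed simp
  have "continuous_on ?S (mat_series C)"
    unfolding mat_series_def
  proof (rule uniform_limit_theorem)
    \<comment> \<open>The majorant \<open>entry_sum (C n)\<close> does not depend on
      \<open>X\<close>, so convergence is uniform and continuity passes to the limit.\<close>
    show "uniform_limit ?S (\<lambda>n X. \<Sum>i<n. C i ** matpow X i) (\<lambda>X. \<Sum>i. C i ** matpow X i) sequentially"
      by (rule Weierstrass_m_test[OF _ summable_entry_sum[OF C_summable]])
        (simp add: norm_mult_matpow_le C_nonneg)
    show "\<forall>\<^sub>F n in sequentially. continuous_on ?S (\<lambda>X. \<Sum>i<n. C i ** matpow X i)"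
      using cont_pow
      by (auto simp: matrix_matrix_mult_def intro!: always_eventually continuous_intros)
  qed simp
  moreover have "mat_series C X \<in> ?S" if "X \<in> ?S" for X
    using that mat_series_nonneg[of C X] mat_series_ones_le[of C X] C_nonneg C_summable
      order_trans[OF _ C_ones] by (auto simp: substochastic_def)
  moreover have "(0 :: 'm sqmat) \<in> ?S"
    by (simp add: substochastic_def ones_nonneg)
  ultimately obtain Y where Y: "substochastic Y" "mat_series C Y = Y"
    using brouwer[OF compact_substochastic convex_substochastic, of "mat_series C"] by blast
  have "(\<lambda>n. C n ** matpow Y n) sums Y"
    using mat_series_sums[OF C_nonneg C_summable Y(1)] Y(2) by simp
  with G Y(1) have "G \<le> Y" "0 \<le> G"
    by (auto simp: min_nonneg_def substochastic_def)
  with Y(1) show ?thesis using substochastic_mono by blast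
qed

section \<open>Reachability of level 0 and subinvariant vectors\<close>

lemma nonneg_mult_row_nonzero:
  fixes M N :: "('m::finite) sqmat"
  assumes "0 \<le> M" "0 \<le> N" "M $ a $ c \<noteq> 0" "N $ c \<noteq> 0"
  shows "(M ** N) $ a \<noteq> 0"
proof -
  obtain b where b: "N $ c $ b \<noteq> 0" using assms(4) by (auto simp: vec_eq_iff)
  have "0 < M $ a $ c * N $ c $ b"
    using assms b by (auto simp: less_eq_vec_def less_le)
  also have "\<dots> \<le> (\<Sum>k\<in>UNIV. M $ a $ k * N $ k $ b)"
    using assms(1,2) by (intro member_le_sum) (auto simp: less_eq_vec_def)
  also have "\<dots> = (M ** N) $ a $ b" by (simp add: matrix_matrix_mult_def)
  finally have "(M ** N) $ a $ b \<noteq> 0" by simp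
  then show ?thesis by (metis zero_index)
qed

text \<open>Probabilistically, row \<open>a\<close> of \<^term>\<open>matpow G i\<close> vanishes iff level \<open>0\<close> cannot be
  reached from the state \<open>(i, a)\<close>.\<close>

lemma matpow_row_nonzero_if_nstep:
  fixes A :: "int \<Rightarrow> ('m::finite) sqmat"
  assumes A_nonneg: "\<And>i. i \<ge> -1 \<Longrightarrow> 0 \<le> A i"
    and G: "0 \<le> G" "solves_mg1 A G"
    and "nstep (mg1_matrix A B) n (i, a) (0, b) \<noteq> 0"
  shows "matpow G i $ a \<noteq> 0"
  using assms(4)
proof (induction n arbitrary: i a)
  case 0
  then show ?case by (auto simp: mat_def vec_eq_iff split: if_splits)
next
  case (Suc n)
  show ?case
  proof (cases i)
    case 0
    then show ?thesis by (auto simp: mat_def vec_eq_iff)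
  next
    case (Suc i')
    \<comment> \<open>An \<open>infsum\<close> of zero terms is zero, so some first step to
      \<open>(j, c)\<close> contributes.\<close>
    obtain j c where jc: "mg1_matrix A B (i, a) (j, c) \<noteq> 0"
      "nstep (mg1_matrix A B) n (j, c) (0, b) \<noteq> 0"
      using Suc.prems infsum_0[of UNIV "\<lambda>u. mg1_matrix A B (i, a) u * nstep (mg1_matrix A B) n u (0, b)"]
      by fastforce
    then have ij: "int j - int i \<ge> -1" and A: "A (int j - int i) $ a $ c \<noteq> 0"
      using Suc by (auto split: if_splits)
    have "0 \<le> A (int k - 1) ** matpow G k" for k
      using A_nonneg G by (intro matrix_mult_nonneg matpow_nonneg) auto
    \<comment> \<open>As \<open>i = Suc i'\<close>, the jump from level \<open>i\<close> to level
      \<open>j\<close> has series index \<open>j - i'\<close>: the coefficient at \<open>n\<close>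
      is \<open>A (int n - 1)\<close>. This one term of the series for \<open>G\<close>, multiplied
      by \<open>matpow G i'\<close> on the right, bounds \<open>matpow G i\<close> from
      below.\<close>
    from member_le_sums_eucl[OF this G(2)[unfolded solves_mg1_def], of "j - i'"]
    have "A (int j - int i) ** matpow G (j - i') \<le> G"
      using ij Suc by (simp add: of_nat_diff algebra_simps)
    then have "(A (int j - int i) ** matpow G (j - i')) ** matpow G i' \<le> matpow G i"
      using Suc G(1) by (simp add: matrix_mult_mono matpow_nonneg)
    moreover have "matpow G (j - i') ** matpow G i' = matpow G j"
      using ij Suc by (simp add: matpow_add[symmetric])
    ultimately have "A (int j - int i) ** matpow G j \<le> matpow G i"
      by (simp add: matrix_mul_assoc[symmetric])
    moreover have "(A (int j - int i) ** matpow G j) $ a \<noteq> 0"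
      using A Suc.IH[OF jc(2)] A_nonneg[OF ij] G(1)
      by (intro nonneg_mult_row_nonzero[of _ _ a c]) (auto simp: matpow_nonneg)
    moreover have "0 \<le> A (int j - int i) ** matpow G j"
      using A_nonneg[OF ij] G(1) by (simp add: matrix_mult_nonneg matpow_nonneg)
    ultimately show ?thesis
      by (auto simp: less_eq_vec_def vec_eq_iff) (metis antisym)
  qed
qed

text \<open>The indices at which \<open>e\<close> is maximal form a closed class \<open>K\<close> of the matrix
  \<^term>\<open>mat_series (\<lambda>i. C (Suc i)) G\<close>, and the rows of \<^term>\<open>C 0\<close> in \<open>K\<close> vanish. Replacing the
  rows of \<open>G\<close> in \<open>K\<close> by zero therefore leaves a supersolution, contradicting minimality.\<close>

lemma subinvariant_vector_zero:
  fixes C :: "nat \<Rightarrow> ('m::finite) sqmat" and e :: "real ^ 'm"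
  assumes C_nonneg: "\<And>n. 0 \<le> C n" and C_summable: "summable C"
    and C_ones: "suminf C *v ones \<le> ones"
    and G: "min_nonneg (\<lambda>X. (\<lambda>n. C n ** matpow X n) sums X) G"
    and rows: "\<And>a. G $ a \<noteq> 0"
    and W: "0 \<le> W" "W \<le> mat_series (\<lambda>i. C (Suc i)) G"
    and e: "0 \<le> e" "e \<le> W *v e"
  shows "e = 0"
proof (rule ccontr)
  assume "e \<noteq> 0"
  define U where "U = mat_series (\<lambda>i. C (Suc i)) G"
  note CS = C_nonneg C_summable
  have CS': "0 \<le> C (Suc n)" "summable (\<lambda>n. C (Suc n))" for n
    by (rule C_nonneg, rule C_summable[THEN summable_Suc_iff[THEN iffD2]])
  have subG: "substochastic G" by (rule min_solution_substochastic[OF CS C_ones G])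
  have G0: "0 \<le> G" using G by (simp add: min_nonneg_def)
  have "(\<lambda>n. C n ** matpow G n) sums G" using G by (simp add: min_nonneg_def)
  from sums_unique2[OF this mat_series_sums[OF CS subG]]
  have G_eq: "G = C 0 + U ** G"
    unfolding U_def mat_series_Suc[OF CS subG] .
  have "suminf C = suminf (\<lambda>i. C (Suc i)) + C 0"
    using suminf_split_head[OF C_summable] by simp
  \<comment> \<open>\<open>C 0\<close> and \<open>U\<close> share the row sums of
    \<open>suminf C\<close>, since substituting a substochastic matrix cannot increase row
    sums.\<close>
  then have "U *v ones + C 0 *v ones \<le> suminf C *v ones"
    using mat_series_ones_le[OF CS' subG]
    by (simp add: U_def matrix_vector_mult_add_rdistrib)
  then have U_ones: "U *v ones + C 0 *v ones \<le> ones"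
    using C_ones by (rule order_trans)
  have U0: "0 \<le> U" unfolding U_def by (rule mat_series_nonneg[OF CS' subG])
  have Ue: "e \<le> U *v e"
    using order_trans[OF e(2) matrix_vector_mult_mono[OF W(2) order_refl _ e(1)]] U0
    by (simp add: U_def)
  define m where "m = Max (range (\<lambda>a. e $ a))"
  define K where "K = {a. e $ a = m}"
  have e_le: "e $ a \<le> m" for a by (simp add: m_def)
  have "m \<in> range (\<lambda>a. e $ a)" unfolding m_def by (intro Max_in) auto
  then obtain k where k: "k \<in> K" by (auto simp: K_def)
  from \<open>e \<noteq> 0\<close> obtain a0 where "e $ a0 \<noteq> 0" by (auto simp: vec_eq_iff)
  with e(1) have "0 < e $ a0" by (simp add: less_eq_vec_def less_le)
  with e_le[of a0] have m: "0 < m" by simp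
  \<comment> \<open>In a row where \<open>e\<close> attains its maximum \<open>m > 0\<close>,
    \<open>m \<le> (U *v e) $ a\<close>, while the row sums of \<open>U\<close> and
    \<open>C 0\<close> together are at most one. The nonnegative terms
    \<open>U $ a $ c * (m - e $ c)\<close> and \<open>m * C 0 $ a $ c\<close> then have total at
    most zero, so all vanish.\<close>
  have K: "C 0 $ a $ b = 0 \<and> (b \<notin> K \<longrightarrow> U $ a $ b = 0)" if a: "a \<in> K" for a b
  proof -
    have nn: "0 \<le> C 0 $ a $ c" "0 \<le> U $ a $ c" for c
      using C_nonneg[of 0] U0 by (auto simp: less_eq_vec_def)
    have "e $ a \<le> (\<Sum>c\<in>UNIV. U $ a $ c * e $ c)"
      using Ue by (simp add: less_eq_vec_def matrix_vector_mult_def)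
    then have "m \<le> (\<Sum>c\<in>UNIV. U $ a $ c * e $ c)"
      using a by (simp add: K_def)
    moreover have "m * ((\<Sum>c\<in>UNIV. U $ a $ c) + (\<Sum>c\<in>UNIV. C 0 $ a $ c)) \<le> m * 1"
      using U_ones m
      by (intro mult_left_mono) (auto simp: less_eq_vec_def ones_def matrix_vector_mult_def)
    ultimately have "(\<Sum>c\<in>UNIV. U $ a $ c * (m - e $ c) + m * C 0 $ a $ c) \<le> 0"
      by (simp add: algebra_simps sum.distrib sum_subtractf sum_distrib_left)
    moreover have pos: "0 \<le> U $ a $ c * (m - e $ c) + m * C 0 $ a $ c" for c
      using nn[of c] m e_le[of c] by simp
    ultimately have "(\<Sum>c\<in>UNIV. U $ a $ c * (m - e $ c) + m * C 0 $ a $ c) = 0"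
      by (intro antisym sum_nonneg) auto
    then have "U $ a $ b * (m - e $ b) + m * C 0 $ a $ b = 0"
      using pos by (simp add: sum_nonneg_eq_0_iff)
    moreover have "0 \<le> U $ a $ b * (m - e $ b)" "0 \<le> m * C 0 $ a $ b"
      using nn[of b] m e_le[of b] by simp_all
    ultimately have "U $ a $ b * (m - e $ b) = 0" "m * C 0 $ a $ b = 0" by linarith+
    then show ?thesis using m by (auto simp: K_def)
  qed
  define G' where "G' = (\<chi> a b. if a \<in> K then 0 else G $ a $ b)"
  have G'0: "0 \<le> G'" and G'_le: "G' \<le> G"
    using G0 by (auto simp: G'_def less_eq_vec_def)
  have subG': "substochastic G'" by (rule substochastic_mono[OF G'0 G'_le subG])
  \<comment> \<open>\<open>U\<close>, evaluated at \<open>G\<close>, dominates the corresponding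
    series at \<open>G'\<close>, so it suffices to treat the affine map with \<open>U\<close>
    fixed.\<close>
  have FG': "mat_series C G' \<le> C 0 + U ** G'"
    using mat_series_mono[OF CS' G'0 G'_le subG] G'0 U0
    by (simp add: mat_series_Suc[OF CS subG'] matrix_mult_mono U_def)
  \<comment> \<open>In \<open>K\<close> the left side vanishes: \<open>U\<close> leads only back to
    \<open>K\<close>, where \<open>G'\<close> is zero. Outside \<open>K\<close>, it is at most
    \<open>C 0 + U ** G\<close>, which is \<open>G\<close>.\<close>
  have "C 0 + U ** G' \<le> G'"
    unfolding less_eq_vec_def
  proof (intro allI)
    fix a b
    show "(C 0 + U ** G') $ a $ b \<le> G' $ a $ b"
    proof (cases "a \<in> K")
      case True
      have "U $ a $ c * G' $ c $ b = 0" for c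
        using K[OF True, of c] by (auto simp: G'_def)
      then have "(U ** G') $ a $ b = 0"
        by (simp add: matrix_matrix_mult_def sum.neutral del: mult_eq_0_iff)
      then show ?thesis using K[OF True, of b] True by (simp add: G'_def)
    next
      case False
      have "C 0 + U ** G' \<le> G"
        using matrix_mult_mono[OF order_refl G'_le U0 G'0] by (subst G_eq) simp
      with False show ?thesis by (simp add: G'_def less_eq_vec_def)
    qed
  qed
  with FG' have prefix: "mat_series C G' \<le> G'" by (rule order_trans)
  have sub: "substochastic Z" if "0 \<le> Z" "Z \<le> G'" for Z
    using substochastic_mono[OF that subG'] .
  have "G \<le> G'"
  proof (rule min_nonneg_le_prefixpoint[where f = "mat_series C", OF G G'0 prefix])
    show "0 \<le> mat_series C Z" if "0 \<le> Z" "Z \<le> G'" for Z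
      by (rule mat_series_nonneg[OF CS sub[OF that]])
    show "mat_series C Z \<le> mat_series C Z'" if "0 \<le> Z" "Z \<le> Z'" "Z' \<le> G'" for Z Z'
      using that by (intro mat_series_mono CS sub) auto
    show "(\<lambda>n. C n ** matpow Z n) sums Z" if "0 \<le> Z" "Z \<le> G'" "mat_series C Z = Z" for Z
      using mat_series_sums[OF CS sub[OF that(1,2)]] that(3) by simp
  qed
  then have "G $ k $ b \<le> G' $ k $ b" for b by (simp add: less_eq_vec_def)
  moreover have "0 \<le> G $ k $ b" for b using G0 by (simp add: less_eq_vec_def)
  ultimately have "G $ k $ b = 0" for b
    using k by (simp add: G'_def antisym)
  then have "G $ k = 0" by (simp add: vec_eq_iff)
  with rows show False by blast
qed


text \<open>As \<open>W\<close> is nonnegative, the positive part of each column of \<open>D\<close>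
  is again subinvariant, so \<open>zero\<close> annihilates it.\<close>

lemma subinvariant_matrix_nonpos:
  fixes W D :: "('m::finite) sqmat"
  assumes W: "0 \<le> W" and D: "D \<le> W ** D"
    and zero: "\<And>e. 0 \<le> e \<Longrightarrow> e \<le> W *v e \<Longrightarrow> e = 0"
  shows "D \<le> 0"
proof -
  have "D $ a $ b \<le> 0" for a b
  proof -
    define e where "e = (\<chi> a. max 0 (D $ a $ b))"
    have e0: "0 \<le> e" by (simp add: e_def less_eq_vec_def)
    have "e $ c \<le> (W *v e) $ c" for c
    proof -
      have "D $ c $ b \<le> (\<Sum>d\<in>UNIV. W $ c $ d * D $ d $ b)"
        using D by (simp add: less_eq_vec_def matrix_matrix_mult_def)
      also have "\<dots> \<le> (W *v e) $ c"
        using W unfolding matrix_vector_mult_def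
        by (auto simp: e_def less_eq_vec_def intro!: sum_mono mult_left_mono)
      finally show ?thesis
        using matrix_vector_mult_nonneg[OF W e0] by (simp add: e_def less_eq_vec_def)
    qed
    then have "e = 0" using zero e0 by (simp add: less_eq_vec_def)
    then have "e $ a = 0" by simp
    then show ?thesis by (simp add: e_def)
  qed
  then show ?thesis by (simp add: less_eq_vec_def)
qed

section \<open>Coefficients of the split power series\<close>

lemma sum_int_minus_one_upto:
  "(\<Sum>l = -1..int q. f l) = f (-1) + (\<Sum>l\<le>q. f (int l))"
proof -
  have "{-1..int q} = insert (-1) (int ` {0..q})"
    by (auto simp: image_int_atLeastAtMost)
  then have "(\<Sum>l = -1..int q. f l) = f (-1) + sum f (int ` {0..q})"
    by (simp add: image_int_atLeastAtMost)
  then show ?thesis by (simp add: sum.reindex atMost_atLeast0)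
qed

text \<open>Coefficients of \<open>z ^ (n + 1)\<close> are compared. The constant series for
  \<open>l = -1\<close> contributes only at \<open>z ^ 0\<close> and drops out; the factor
  \<open>z ^ (l + 1)\<close> shifts the others to index \<open>n - l\<close>.\<close>

lemma series_splitting_coeff:
  fixes A :: "int \<Rightarrow> ('m::finite) sqmat"
  assumes split: "series_splitting A q AL"
    and const: "\<And>i. AL (-1) i = (if i = 0 then A (-1) else 0)"
  shows "A (int n) = (\<Sum>l\<le>q. if n < l then 0 else AL (int l) (n - l))"
proof -
  have "A (int n) $ a $ b = (\<Sum>l\<le>q. if n < l then 0 else AL (int l) (n - l)) $ a $ b" for a b
  proof -
    have "fps_nth (\<Sum>l = -1..int q. Abs_fps (\<lambda>i. AL l i $ a $ b) * fps_X ^ nat (l + 1)) (Suc n)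
        = A (int n) $ a $ b"
      using split by (simp add: series_splitting_def)
    then show ?thesis
      by (simp add: fps_sum_nth fps_X_power_mult_right_nth sum_int_minus_one_upto const
          nat_add_distrib if_distrib[of "\<lambda>M. M $ a $ b"] del: power_Suc cong: if_cong)
  qed
  then show ?thesis by (simp add: vec_eq_iff)
qed

text \<open>Substituting a matrix for \<open>z\<close> respects the shifts by \<open>l\<close>:
  coefficients stand on the left, and powers of one matrix add exponents.\<close>

lemma mat_series_convolution:
  fixes D :: "nat \<Rightarrow> nat \<Rightarrow> ('m::finite) sqmat"
  assumes D_nonneg: "\<And>l i. l \<le> q \<Longrightarrow> 0 \<le> D l i"
    and D_summable: "\<And>l. l \<le> q \<Longrightarrow> summable (D l)"
    and U: "\<And>n. U n = (\<Sum>l\<le>q. if n < l then 0 else D l (n - l))"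
    and X: "substochastic X"
  shows "(\<Sum>l\<le>q. mat_series (D l) X ** matpow X l) = mat_series U X"
proof -
  have "(\<lambda>n. (if n < l then 0 else D l (n - l)) ** matpow X n) sums (mat_series (D l) X ** matpow X l)"
    if "l \<le> q" for l
  proof -
    have "(\<lambda>i. D l i ** matpow X i ** matpow X l) sums (mat_series (D l) X ** matpow X l)"
      using that by (intro bounded_linear.sums[OF bounded_linear_matrix_mult_left] mat_series_sums
          D_nonneg D_summable X)
    then have "(\<lambda>i. (if i + l < l then 0 else D l (i + l - l)) ** matpow X (i + l))
        sums (mat_series (D l) X ** matpow X l)"
      by (simp add: matpow_add matrix_mul_assoc)
    then show ?thesis by (subst (asm) sums_zero_iff_shift) auto
  qed
  then have "(\<lambda>n. \<Sum>l\<le>q. (if n < l then 0 else D l (n - l)) ** matpow X n)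
      sums (\<Sum>l\<le>q. mat_series (D l) X ** matpow X l)"
    by (intro sums_sum) auto
  moreover have "(\<Sum>l\<le>q. (if n < l then 0 else D l (n - l)) ** matpow X n) = U n ** matpow X n" for n
    unfolding U
    by (rule linear_sum[OF bounded_linear.linear[OF bounded_linear_matrix_mult_left], symmetric])
  ultimately show ?thesis by (simp add: mat_series_def sums_iff)
qed

section \<open>Comparison of convergence rates\<close>

lemma infnorm_mono:
  fixes x y :: "'a::ordered_euclidean_space"
  assumes "0 \<le> x" "x \<le> y"
  shows "infnorm x \<le> infnorm y"
proof -
  have "\<bar>x \<bullet> i\<bar> \<le> infnorm y" if "i \<in> Basis" for i
  proof -
    have "0 \<le> x \<bullet> i" "x \<bullet> i \<le> y \<bullet> i"
      using inner_Basis_mono[OF assms(1) that] inner_Basis_mono[OF assms(2) that] by simp_all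
    then show ?thesis using Basis_le_infnorm[OF that, of y] by linarith
  qed
  then show ?thesis unfolding infnorm_Max[of x] by simp
qed

text \<open>By \<open>eq\<close> both errors are divided by the same nonnegative number, so their
  order survives for each \<open>k\<close>; at \<open>k = 0\<close> both roots are 0.\<close>

lemma conv_rate_mono:
  assumes le: "\<And>k. X2 k \<le> X1 k" "\<And>k. X1 k \<le> G" and eq: "X1 0 = X2 0"
  shows "conv_rate G X1 \<le> conv_rate G X2"
  unfolding conv_rate_def
proof (intro Limsup_mono always_eventually allI)
  fix k
  have "0 \<le> (G - X1 k) *v ones" "(G - X1 k) *v ones \<le> (G - X2 k) *v ones"
    using le[of k] order_trans[OF le, of k]
    by (auto intro!: matrix_vector_mult_nonneg matrix_vector_mult_mono simp: ones_nonneg)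
  then have "infnorm (error_vec G X1 k) \<le> infnorm (error_vec G X2 k)"
    unfolding error_vec_def by (rule infnorm_mono)
  then have "infnorm (error_vec G X1 k) / infnorm (error_vec G X1 0)
      \<le> infnorm (error_vec G X2 k) / infnorm (error_vec G X2 0)"
    by (simp add: error_vec_def eq divide_right_mono infnorm_pos_le)
  then show "ereal (root k (infnorm (error_vec G X1 k) / infnorm (error_vec G X1 0)))
      \<le> ereal (root k (infnorm (error_vec G X2 k) / infnorm (error_vec G X2 0)))"
    by (cases "k = 0") simp_all
qed

section \<open>Comparison of the two iterations\<close>

theorem theorem10:
  fixes A :: "int \<Rightarrow> real ^ 'm ^ 'm"
    and B :: "nat \<Rightarrow> real ^ 'm ^ 'm"
    and AL :: "int \<Rightarrow> nat \<Rightarrow> real ^ 'm ^ 'm"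
    and G :: "real ^ 'm ^ 'm"
    and X1 X2 :: "nat \<Rightarrow> real ^ 'm ^ 'm"
    and q :: nat
  assumes A_nonneg: "\<And>i. i \<ge> -1 \<Longrightarrow> 0 \<le> A i"
    and B_nonneg: "\<And>i. 0 \<le> B i"
    and B_stoch: "summable B" "stochastic (\<Sum>i. B i)"
    and A_stoch: "summable (\<lambda>n. A (int n - 1))" "stochastic (\<Sum>n. A (int n - 1))"
    and A_irred: "irreducible_mat (\<Sum>n. A (int n - 1))"
    and P_irred: "irreducible_chain (mg1_matrix A B)"
    and P_aper: "aperiodic_chain (mg1_matrix A B)"
    and A_mean: "summable (\<lambda>n. real_of_int (int n - 1) *\<^sub>R A (int n - 1))"
    and G: "min_nonneg (solves_mg1 A) G"
    and q: "q \<ge> 1"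
    and AL_nonneg: "\<And>l i. -1 \<le> l \<Longrightarrow> l \<le> int q \<Longrightarrow> 0 \<le> AL l i"
    and AL_split: "series_splitting A q AL"
    and AL_const: "\<And>i. AL (-1) i = (if i = 0 then A (-1) else 0)"
    and X1_0: "X1 0 = 0"
    and X1_Suc: "\<And>k. min_nonneg
        (\<lambda>X. X = (\<Sum>l = -1..int q. mat_series (AL l) (X1 k) ** matpow X (nat (l + 1))))
        (X1 (Suc k))"
    and X2_0: "X2 0 = 0"
    and X2_Suc: "\<And>k. (mat 1 - mat_series (\<lambda>i. A (int i)) (X2 k)) ** X2 (Suc k) = A (-1)"
  shows "conv_rate G X1 \<le> conv_rate G X2"
proof -
  define C where "C = (\<lambda>n. A (int n - 1))"
  define U where "U = (\<lambda>i. C (Suc i))"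
  define D where "D = (\<lambda>l. AL (int l))"
  have C_nonneg: "0 \<le> C n" for n using A_nonneg by (simp add: C_def)
  have C_summable: "summable C" using A_stoch(1) by (simp add: C_def)
  note CS = C_nonneg C_summable
  have C_ones: "suminf C *v ones \<le> ones"
    using A_stoch(2) by (simp add: C_def stochastic_def)
  have U_nonneg: "0 \<le> U n" and U_summable: "summable U" for n
    unfolding U_def by (rule C_nonneg, rule C_summable[THEN summable_Suc_iff[THEN iffD2]])
  note US = U_nonneg U_summable
  have U_eq: "(\<lambda>i. A (int i)) = U" by (simp add: U_def C_def)
  have G_min: "min_nonneg (\<lambda>X. (\<lambda>n. C n ** matpow X n) sums X) G"
    using G by (simp add: solves_mg1_def[abs_def] C_def)
  have G0: "0 \<le> G" and G_sums: "(\<lambda>n. C n ** matpow G n) sums G"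
    using G_min by (auto simp: min_nonneg_def)
  have subG: "substochastic G" by (rule min_solution_substochastic[OF CS C_ones G_min])
  from sums_unique2[OF G_sums mat_series_sums[OF CS subG]]
  have G_eq: "G = C 0 + mat_series U G ** G"
    unfolding U_def mat_series_Suc[OF CS subG] .
  have sub: "substochastic X" if "0 \<le> X" "X \<le> G" for X
    using substochastic_mono[OF that subG] .
  have rows: "G $ a \<noteq> 0" for a
  proof -
    \<comment> \<open>By irreducibility level 0 is reachable from \<open>(1, a)\<close>, so row
      \<open>a\<close> of \<open>matpow G 1\<close>, that is of \<open>G\<close>, is
      nonzero.\<close>
    obtain n where "nstep (mg1_matrix A B) n (1, a) (0, a) > 0"
      using P_irred unfolding irreducible_chain_def by blast
    then have "nstep (mg1_matrix A B) n (1, a) (0, a) \<noteq> 0" by simp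
    from matpow_row_nonzero_if_nstep[OF A_nonneg G0 _ this] G
    show ?thesis by (simp add: min_nonneg_def)
  qed

  have D_nonneg: "0 \<le> D l i" if "l \<le> q" for l i
    using AL_nonneg[of "int l" i] that by (simp add: D_def)
  have U_conv: "U n = (\<Sum>l\<le>q. if n < l then 0 else D l (n - l))" for n
    unfolding U_eq[symmetric] D_def by (rule series_splitting_coeff[where A = A, OF AL_split AL_const])
  \<comment> \<open>\<open>D l n\<close> is one of the nonnegative summands of
    \<open>U (n + l)\<close>.\<close>
  have D_summable: "summable (D l)" if "l \<le> q" for l
  proof (rule summable_nonneg_comparison)
    show "summable (\<lambda>n. U (n + l))" using U_summable by (rule summable_ignore_initial_segment)
    fix n
    show "0 \<le> D l n" using D_nonneg that .
    have "0 \<le> (\<Sum>j\<in>{..q} - {l}. if n + l < j then 0 else D j (n + l - j))"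
      using D_nonneg by (intro sum_nonneg) auto
    moreover have "U (n + l) = D l n + (\<Sum>j\<in>{..q} - {l}. if n + l < j then 0 else D j (n + l - j))"
      unfolding U_conv using that by (subst sum.remove[of _ l]) auto
    ultimately show "D l n \<le> U (n + l)" by simp
  qed

  \<comment> \<open>Apart from the constant term \<open>C 0\<close>, \<open>Q Y X\<close> is the
    factor multiplying \<open>X\<close> in the first iteration, with \<open>Y\<close> frozen in the
    coefficients. On the diagonal it is the matrix \<open>mat_series U X\<close> of the U-based
    iteration, which makes the two comparable.\<close>
  define Q where "Q = (\<lambda>Y X. \<Sum>l\<le>q. mat_series (D l) Y ** matpow X l)"
  have Q_diag: "Q X X = mat_series U X" if "0 \<le> X" "X \<le> G" for X
    unfolding Q_def by (rule mat_series_convolution[OF D_nonneg D_summable U_conv sub[OF that]])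
  have Q_nonneg: "0 \<le> Q Y X" if "0 \<le> Y" "Y \<le> G" "0 \<le> X" for Y X
    unfolding Q_def using that sub[of Y] D_nonneg D_summable
    by (intro sum_nonneg matrix_mult_nonneg mat_series_nonneg matpow_nonneg) auto
  have Q_mono: "Q Y X \<le> Q Y' X'" if "0 \<le> Y" "Y \<le> Y'" "Y' \<le> G" "0 \<le> X" "X \<le> X'" for Y Y' X X'
    unfolding Q_def using that sub[of Y'] order_trans[OF that(1,2)] D_nonneg D_summable
    by (intro sum_mono matrix_mult_mono mat_series_mono mat_series_nonneg matpow_nonneg matpow_mono) auto

  have AL_minus_one: "mat_series (AL (-1)) Y = C 0" for Y
  proof -
    have "(\<lambda>i. AL (-1) i ** matpow Y i) = (\<lambda>i. if i = 0 then C 0 else 0)"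
      by (auto simp: AL_const C_def)
    then show ?thesis using sums_single[of 0 "\<lambda>i. C 0"]
      by (simp add: mat_series_def sums_iff)
  qed
  have step_eq: "(\<Sum>l = -1..int q. mat_series (AL l) Y ** matpow X (nat (l + 1))) = C 0 + Q Y X ** X"
    for X Y
  proof -
    have "(\<Sum>l\<le>q. mat_series (AL (int l)) Y ** matpow X (nat (int l + 1)))
        = (\<Sum>l\<le>q. mat_series (D l) Y ** matpow X l ** X)"
      by (intro sum.cong refl)
        (simp add: D_def nat_add_distrib matpow_Suc_right matrix_mul_assoc del: matpow.simps)
    also have "\<dots> = Q Y X ** X" unfolding Q_def
      by (rule linear_sum[OF bounded_linear.linear[OF bounded_linear_matrix_mult_left], symmetric])
    finally show ?thesis by (simp add: sum_int_minus_one_upto AL_minus_one)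
  qed
  have X1_min: "min_nonneg (\<lambda>X. X = C 0 + Q (X1 k) X ** X) (X1 (Suc k))" for k
    using X1_Suc[of k] by (simp add: step_eq)
  have X1_eq: "X1 (Suc k) = C 0 + Q (X1 k) (X1 (Suc k)) ** X1 (Suc k)" for k
    using X1_min[of k] by (simp add: min_nonneg_def)
  have X1_nonneg: "0 \<le> X1 k" for k
    using X1_min[of "k - 1"] X1_0 by (cases k) (auto simp: min_nonneg_def)
  have X1_below: "X1 (Suc k) \<le> Y"
    if "X1 k \<le> G" "0 \<le> Y" "C 0 + Q (X1 k) Y ** Y \<le> Y" for k Y
  proof (rule min_nonneg_le_prefixpoint[where f = "\<lambda>Z. C 0 + Q (X1 k) Z ** Z", OF X1_min that(2,3)])
    show "0 \<le> C 0 + Q (X1 k) Z ** Z" if "0 \<le> Z" for Z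
      using that \<open>X1 k \<le> G\<close> by (intro add_nonneg_nonneg C_nonneg matrix_mult_nonneg Q_nonneg X1_nonneg)
    show "C 0 + Q (X1 k) Z ** Z \<le> C 0 + Q (X1 k) Z' ** Z'" if "0 \<le> Z" "Z \<le> Z'" for Z Z'
      using that \<open>X1 k \<le> G\<close> order_trans[OF that]
      by (intro add_left_mono matrix_mult_mono Q_mono Q_nonneg X1_nonneg order_refl)
  qed simp
  have X1_le_G: "X1 k \<le> G" for k
  proof (induction k)
    case (Suc k)
    \<comment> \<open>Freezing the coefficients at \<open>X1 k \<le> G\<close> lowers them, so
      \<open>G\<close> is a supersolution of the equation for \<open>X1 (Suc k)\<close>.\<close>
    have "C 0 + Q (X1 k) G ** G \<le> C 0 + mat_series U G ** G"
      unfolding Q_diag[OF G0 order_refl, symmetric] using Suc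
      by (intro add_left_mono matrix_mult_mono Q_mono Q_nonneg X1_nonneg G0 order_refl)
    with G_eq show ?case using X1_below[OF Suc G0] by simp
  qed (simp add: X1_0 G0)
  have X1_mono: "X1 k \<le> X1 (Suc k)" for k
  proof (induction k)
    case (Suc k)
    \<comment> \<open>\<open>X1 (Suc (Suc k))\<close> solves the equation frozen at
      \<open>X1 (Suc k)\<close>, whose coefficients dominate those at \<open>X1 k\<close> by
      induction. It is thus a supersolution of the equation for \<open>X1 (Suc k)\<close>.\<close>
    have "C 0 + Q (X1 k) (X1 (Suc (Suc k))) ** X1 (Suc (Suc k)) \<le> X1 (Suc (Suc k))"
      by (subst (3) X1_eq)
        (intro add_left_mono matrix_mult_mono Q_mono Q_nonneg X1_nonneg X1_le_G Suc order_refl)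
    then show ?case by (intro X1_below X1_le_G X1_nonneg)
  qed (simp add: X1_0 X1_nonneg)

  have X2_bounds: "0 \<le> X2 k \<and> X2 k \<le> X1 k" for k
  proof (induction k)
    case (Suc k)
    define W where "W = mat_series U (X2 k)"
    let ?X = "X2 (Suc k)" and ?Y = "X1 (Suc k)" and ?V = "Q (X1 k) (X1 (Suc k))"
    have X2G: "X2 k \<le> G" using Suc X1_le_G order_trans by blast
    have W0: "0 \<le> W" unfolding W_def
      using Suc X2G by (intro mat_series_nonneg US sub) auto
    have WG: "W \<le> mat_series U G" unfolding W_def
      using Suc X2G by (intro mat_series_mono US subG) auto
    have "W \<le> mat_series U (X1 k)" unfolding W_def
      using Suc by (intro mat_series_mono US sub X1_nonneg X1_le_G) auto
    also have "\<dots> = Q (X1 k) (X1 k)" by (simp add: Q_diag X1_nonneg X1_le_G)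
    also have "\<dots> \<le> ?V" by (intro Q_mono X1_nonneg X1_le_G X1_mono order_refl)
    finally have WV: "W \<le> ?V" .
    have zero: "e = 0" if "0 \<le> e" "e \<le> W *v e" for e
      by (rule subinvariant_vector_zero[OF CS C_ones G_min rows W0 WG[unfolded U_def] that])
    have diff: "(M - N) ** Z = M ** Z - N ** Z" for M N Z :: "real ^ 'm ^ 'm"
      by (rule linear_diff[OF bounded_linear.linear[OF bounded_linear_matrix_mult_left]])
    have X: "?X = C 0 + W ** ?X"
      using X2_Suc[of k] by (simp add: U_eq W_def[symmetric] C_def diff algebra_simps)
    have neg: "W ** (- Z) = - (W ** Z)" for Z
      by (simp add: matrix_matrix_mult_def vec_eq_iff sum_negf)
    \<comment> \<open>The recursion prescribes only a linear equation, so nonnegativity must be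
      proved: as \<open>C 0\<close> is nonnegative, \<open>- ?X\<close> is subinvariant under
      \<open>W\<close> and hence nonpositive.\<close>
    have "- ?X \<le> W ** (- ?X)"
      by (subst X) (simp add: neg C_nonneg)
    from subinvariant_matrix_nonpos[OF W0 this zero] have "0 \<le> ?X" by simp
    moreover have "?X - ?Y \<le> W ** (?X - ?Y)"
    proof -
      have "W ** ?Y \<le> ?V ** ?Y"
        using order_trans[OF W0 WV] by (intro matrix_mult_mono WV X1_nonneg order_refl)
      moreover have "W ** (?X - ?Y) = W ** ?X - W ** ?Y"
        using matrix_add_ldistrib[of W ?X "- ?Y"] by (simp add: neg)
      moreover have "?X - ?Y = W ** ?X - ?V ** ?Y"
        by (subst X, subst X1_eq) simp
      ultimately show ?thesis by simp
    qed
    from subinvariant_matrix_nonpos[OF W0 this zero] have "?X \<le> ?Y" by simp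
    ultimately show ?case by simp
  qed (simp add: X1_0 X2_0)

  show ?thesis
    using X2_bounds X1_le_G X1_0 X2_0 by (intro conv_rate_mono) auto
qed

end
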